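(* Let $X$ be a quasi-Banach function lattice over a metric measure space $(\mathcal P,d,\mu)$. The equivalence classes in $\widetilde N^1X=N^1X/\!\sim$ (where $u\sim v$ means $\|u-v\|_{N^1X}=0$) are given by equality up to sets of $X$-capacity zero; that is, for $u,v\in N^1X$ one has $\|u-v\|_{N^1X}=0$ if and only if $C_X(\{x\in\mathcal P:u(x)\ne v(x)\})=0$.
   Context: Standing setting: $(\mathcal P,d)$ is a metric space with a $\sigma$-finite Borel regular measure $\mu$ (Borel sets are $\mu$-measurable, and each $\mu$-measurable set $A$ is contained in a Borel set $D$ with $\mu(D)=\mu(A)$), such that every ball has finite positive measure. $\mathcal M(\mathcal P,\mu)$ is the set of extended real-valued $\mu$-measurable functions on $\mathcal P$ (defined everywhere). A quasi-Banach function lattice $X$ is given by a functional $\|\cdot\|_X:\mathcal M(\mathcal P,\mu)\to[0,\infty]$ with $X=\{u\in\mathcal M(\mathcal P,\mu):\|u\|_X<\infty\}$ such that, for some constant $c\ge1$ (the modulus of concavity): (i) $\|u\|_X=0$ iff $u=0$ a.e.; $\|au\|_X=|a|\,\|u\|_X$ for $a\in\mathbb R$; $\|u+v\|_X\le c(\|u\|_X+\|v\|_X)$; (ii) $|u|\le|v|$ a.e. implies $\|u\|_X\le\|v\|_X$; (iii) (Riesz–Fischer) if $u_n\ge0$ a.e. for all $n\ge 1$, then $\bigl\|\sum_{n=1}^\infty u_n\bigr\|_X\le\sum_{n=1}^\infty c^n\|u_n\|_X$. Moreover, $\|\cdot\|_X$ is assumed continuous: $\|u_n-u\|_X\to0$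 implies $\|u_n\|_X\to\|u\|_X$. Elements of $X$ are functions defined everywhere, not a.e. equivalence classes. A curve is a non-constant rectifiable continuous map from a compact interval to $\mathcal P$, always parametrized by arc length, $\gamma:[0,l_\gamma]\to\mathcal P$. A Borel function $g:\mathcal P\to[0,\infty]$ is an upper gradient of $u:\mathcal P\to\overline{\mathbb R}=\mathbb{R}\cup\{\pm\infty\}$ if $|u(\gamma(0))-u(\gamma(l_\gamma))|\le\int_\gamma g\,ds$ for all curves $\gamma$, with the convention $|(\pm\infty)-(\pm\infty)|=\infty$ in this inequality. For $u\in\mathcal M(\mathcal P,\mu)$, $\|u\|_{N^1X}=\|u\|_X+\inf_g\|g\|_X$, the infimum being over all upper gradients $g$ of $u$; $N^1X=\{u\in\mathcal M(\mathcal P,\mu):\|u\|_{N^1X}<\infty\}$ (functions defined everywhere). When forming differences of functions pointwise, the value at points where the expression is of the form $\infty-\infty$ is taken to be $0$. The (Sobolev) $X$-capacity of $E\subset\mathcal P$ is $C_X(E)=\inf\{\|u\|_{N^1X}:u\ge1\text{ on }E\}$. *)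

theory Defs
  imports "HOL-Analysis.Analysis"
begin

section \<open>Metric measure spaces\<close>

locale metric_measure_space = sigma_finite_measure M
  for M :: "'a::metric_space measure" +
  assumes space_eq_UNIV: "space M = UNIV"
    and borel_measurable_sets: "sets borel \<subseteq> sets M"
    and borel_regular:
      "A \<in> sets M \<Longrightarrow> \<exists>D\<in>sets borel. A \<subseteq> D \<and> emeasure M D = emeasure M A"
    and ball_pos_finite: "0 < r \<Longrightarrow> 0 < emeasure M (ball x r) \<and> emeasure M (ball x r) < \<infinity>"

section \<open>Arithmetic of extended real-valued functions\<close>

text \<open>Expressions of the form \<open>\<infinity> - \<infinity>\<close> are given the value 0, in differences and, accordingly,
  in sums; the library's \<open>ereal\<close> subtraction gives \<open>\<infinity>\<close> instead.\<close>

definition ext_diff :: "ereal \<Rightarrow> ereal \<Rightarrow> ereal" where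
  "ext_diff x y = (if \<bar>x\<bar> = \<infinity> \<and> x = y then 0 else x - y)"

definition ext_add :: "ereal \<Rightarrow> ereal \<Rightarrow> ereal" where
  "ext_add x y = ext_diff x (- y)"

definition fun_diff :: "('a \<Rightarrow> ereal) \<Rightarrow> ('a \<Rightarrow> ereal) \<Rightarrow> 'a \<Rightarrow> ereal" where
  "fun_diff u v = (\<lambda>x. ext_diff (u x) (v x))"

definition fun_add :: "('a \<Rightarrow> ereal) \<Rightarrow> ('a \<Rightarrow> ereal) \<Rightarrow> 'a \<Rightarrow> ereal" where
  "fun_add u v = (\<lambda>x. ext_add (u x) (v x))"

section \<open>Quasi-Banach function lattices\<close>

text \<open>The lattice is represented by its functional \<open>N\<close>, whose values matter only on the
  measurable functions. The sequence in the Riesz--Fischer axiom is indexed from 0, whence the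
  exponent \<open>Suc n\<close>; the terms are only almost everywhere non-negative, and the value of the series
  elsewhere is immaterial by \<open>norm_mono\<close>.\<close>

locale quasi_banach_function_lattice = metric_measure_space M
  for M :: "'a::metric_space measure" +
  fixes N :: "('a \<Rightarrow> ereal) \<Rightarrow> ennreal"
    and c :: real
  assumes modulus_ge_1: "1 \<le> c"
    and norm_eq_0_iff: "u \<in> borel_measurable M \<Longrightarrow> N u = 0 \<longleftrightarrow> (AE x in M. u x = 0)"
    and norm_scale: "u \<in> borel_measurable M \<Longrightarrow> N (\<lambda>x. ereal a * u x) = ennreal \<bar>a\<bar> * N u"
    and norm_triangle:
      "u \<in> borel_measurable M \<Longrightarrow> v \<in> borel_measurable M \<Longrightarrow>
        N (fun_add u v) \<le> ennreal c * (N u + N v)"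
    and norm_mono:
      "u \<in> borel_measurable M \<Longrightarrow> v \<in> borel_measurable M \<Longrightarrow>
        (AE x in M. \<bar>u x\<bar> \<le> \<bar>v x\<bar>) \<Longrightarrow> N u \<le> N v"
    and riesz_fischer:
      "(\<And>n. f n \<in> borel_measurable M) \<Longrightarrow> (\<And>n. AE x in M. 0 \<le> f n x) \<Longrightarrow>
        N (\<lambda>x. \<Sum>n. f n x) \<le> (\<Sum>n. ennreal (c ^ Suc n) * N (f n))"
    and norm_continuous:
      "(\<And>n. f n \<in> borel_measurable M) \<Longrightarrow> u \<in> borel_measurable M \<Longrightarrow>
        (\<lambda>n. N (fun_diff (f n) u)) \<longlonglongrightarrow> 0 \<Longrightarrow> (\<lambda>n. N (f n)) \<longlonglongrightarrow> N u"

section \<open>Curves and upper gradients\<close>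

definition curve_length :: "(real \<Rightarrow> 'a::metric_space) \<Rightarrow> real \<Rightarrow> real \<Rightarrow> ennreal" where
  "curve_length \<gamma> a b =
    (SUP (n, t) \<in> {(n, t :: nat \<Rightarrow> real). t 0 = a \<and> t n = b \<and> (\<forall>i<n. t i \<le> t (Suc i))}.
      \<Sum>i<n. ennreal (dist (\<gamma> (t i)) (\<gamma> (t (Suc i)))))"

definition rectifiable_curve :: "(real \<Rightarrow> 'a::metric_space) \<Rightarrow> real \<Rightarrow> real \<Rightarrow> bool" where
  "rectifiable_curve \<gamma> a b \<longleftrightarrow>
    a \<le> b \<and> continuous_on {a..b} \<gamma> \<and> \<not> \<gamma> constant_on {a..b} \<and> curve_length \<gamma> a b < \<infinity>"

definition arc_length_curve :: "(real \<Rightarrow> 'a::metric_space) \<Rightarrow> real \<Rightarrow> bool" where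
  "arc_length_curve \<gamma> l \<longleftrightarrow>
    rectifiable_curve \<gamma> 0 l \<and>
    (\<forall>s t. 0 \<le> s \<and> s \<le> t \<and> t \<le> l \<longrightarrow> curve_length \<gamma> s t = ennreal (t - s))"

text \<open>Here the library's subtraction on \<open>ereal\<close> is the right one: it realises the convention
  \<open>\<bar>(\<plusminus>\<infinity>) - (\<plusminus>\<infinity>)\<bar> = \<infinity>\<close>.\<close>

lemma abs_ereal_diff_infinite:
  fixes x y :: ereal
  assumes "\<bar>x\<bar> = \<infinity>" "\<bar>y\<bar> = \<infinity>"
  shows "\<bar>x - y\<bar> = \<infinity>"
  using assms by (cases x; cases y) auto

definition upper_gradient :: "('a::metric_space \<Rightarrow> ennreal) \<Rightarrow> ('a \<Rightarrow> ereal) \<Rightarrow> bool" where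
  "upper_gradient g u \<longleftrightarrow>
    g \<in> borel_measurable borel \<and>
    (\<forall>\<gamma> l. arc_length_curve \<gamma> l \<longrightarrow>
      \<bar>u (\<gamma> 0) - u (\<gamma> l)\<bar> \<le> enn2ereal (\<integral>\<^sup>+s\<in>{0..l}. g (\<gamma> s) \<partial>lborel))"

section \<open>The Newtonian space and the Sobolev capacity\<close>

definition newtonian_norm :: "(('a::metric_space \<Rightarrow> ereal) \<Rightarrow> ennreal) \<Rightarrow> ('a \<Rightarrow> ereal) \<Rightarrow> ennreal" where
  "newtonian_norm N u = N u + (INF g \<in> {g. upper_gradient g u}. N (\<lambda>x. enn2ereal (g x)))"

definition newtonian_space ::
    "'a::metric_space measure \<Rightarrow> (('a \<Rightarrow> ereal) \<Rightarrow> ennreal) \<Rightarrow> ('a \<Rightarrow> ereal) set" where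
  "newtonian_space M N = {u \<in> borel_measurable M. newtonian_norm N u < \<infinity>}"

definition newtonian_rel ::
    "'a::metric_space measure \<Rightarrow> (('a \<Rightarrow> ereal) \<Rightarrow> ennreal) \<Rightarrow> (('a \<Rightarrow> ereal) \<times> ('a \<Rightarrow> ereal)) set" where
  "newtonian_rel M N =
    {(u, v). u \<in> newtonian_space M N \<and> v \<in> newtonian_space M N \<and>
      newtonian_norm N (fun_diff u v) = 0}"

definition newtonian_quotient ::
    "'a::metric_space measure \<Rightarrow> (('a \<Rightarrow> ereal) \<Rightarrow> ennreal) \<Rightarrow> ('a \<Rightarrow> ereal) set set" where
  "newtonian_quotient M N = newtonian_space M N // newtonian_rel M N"

definition sobolev_capacity ::
    "'a::metric_space measure \<Rightarrow> (('a \<Rightarrow> ereal) \<Rightarrow> ennreal) \<Rightarrow> 'a set \<Rightarrow> ennreal" where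
  "sobolev_capacity M N E =
    (INF u \<in> {u \<in> newtonian_space M N. \<forall>x\<in>E. 1 \<le> u x}. newtonian_norm N u)"

end

theory Submission
  imports Defs
begin

text \<open>Since \<open>ext_diff\<close> vanishes exactly where its arguments agree, with
  \<open>w = fun_diff u v\<close> the claim is that \<open>w\<close> has Newtonian norm zero iff the
  set E where \<open>w\<close> is non-zero has capacity zero. In both directions, upper gradients
  g_n with rapidly decreasing norms are added up: by Riesz-Fischer the sum still has small norm
  (\<open>norm_suminf_le\<close>), while along a curve where its integral is finite the integrals of
  the g_n tend to 0. If \<open>w\<close> has norm zero, take the g_n to be upper gradients of
  \<open>w\<close>. On a curve with finite total integral the end values of \<open>w\<close> agree,
  so the sum is an upper gradient of the indicator of E. That indicator is then a competitor of norm
  zero (\<open>newtonian_norm_indicator_support\<close>). If E has capacity zero, take competitors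
  u_n for E with tiny norms, and upper gradients g_n of them. As u_n is at least 1 on E, the
  indicator of E, and hence \<open>w\<close>, vanishes almost everywhere. A curve with an end in E
  and finite total integral of the g_n keeps \<bar>u_n\<bar> away from 0 for all large n, so the sum
  of the \<bar>u_n\<bar> is infinite along it (\<open>sum_infinite_along_curve\<close>). Such points
  form a null set (\<open>null_infinite_set\<close>), and making the sum of the g_n infinite on a
  Borel null superset gives an upper gradient of \<open>w\<close> of arbitrarily small norm.\<close>

section \<open>Extended real preliminaries\<close>

lemma ext_diff_eq_0_iff: "ext_diff x y = 0 \<longleftrightarrow> x = y"
  by (cases x; cases y) (auto simp: ext_diff_def)

lemma ennreal_suminf_finite_imp_tendsto_0:
  fixes a :: "nat \<Rightarrow> ennreal"
  assumes "(\<Sum>n. a n) \<noteq> \<infinity>"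
  shows "a \<longlonglongrightarrow> 0"
proof -
  have "a n \<noteq> top" for n
    using assms ennreal_suminf_lessD[of a top n] by (auto simp: less_top)
  then have a: "a n = ennreal (enn2real (a n))" for n
    by (simp add: less_top)
  have "summable (\<lambda>n. enn2real (a n))"
    using assms a by (intro summable_suminf_not_top) (auto simp flip: a)
  then have "(\<lambda>n. enn2real (a n)) \<longlonglongrightarrow> 0"
    by (rule summable_LIMSEQ_zero)
  then have "(\<lambda>n. ennreal (enn2real (a n))) \<longlonglongrightarrow> ennreal 0"
    by (rule tendsto_ennrealI)
  then show ?thesis
    using a by (simp flip: a)
qed

section \<open>Curves and integrals along them\<close>

lemma arc_length_curve_pos:
  assumes "arc_length_curve \<gamma> l"
  shows "0 < l"
proof (rule ccontr)
  assume "\<not> 0 < l"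
  then have "{0..l} \<subseteq> {0}"
    by auto
  then have "\<gamma> constant_on {0..l}"
    by (auto simp: constant_on_def)
  with assms show False
    by (simp add: arc_length_curve_def rectifiable_curve_def)
qed

text \<open>Only non-constancy needs an argument: a constant piece would have length 0, whereas the
  parametrization by arc length gives it length \<open>s\<close>.\<close>

lemma arc_length_curve_initial:
  assumes "arc_length_curve \<gamma> l" "0 < s" "s \<le> l"
  shows "arc_length_curve \<gamma> s"
proof -
  have len: "curve_length \<gamma> a b = ennreal (b - a)" if "0 \<le> a" "a \<le> b" "b \<le> l" for a b
    using assms that by (auto simp: arc_length_curve_def)
  have "\<not> \<gamma> constant_on {0..s}"
  proof
    assume "\<gamma> constant_on {0..s}"
    then obtain y where y: "\<And>t. t \<in> {0..s} \<Longrightarrow> \<gamma> t = y"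
      by (auto simp: constant_on_def)
    have "(\<Sum>i<n. ennreal (dist (\<gamma> (t i)) (\<gamma> (t (Suc i))))) = 0"
      if t: "t 0 = 0" "t n = s" "\<forall>i<n. t i \<le> t (Suc i)" for n and t :: "nat \<Rightarrow> real"
    proof -
      have mono: "t i \<le> t j" if "i \<le> j" "j \<le> n" for i j
        using that(1) that(2)
        by (induction rule: dec_induct) (auto intro!: order_trans[OF _ t(3)[rule_format]])
      have "t i \<in> {0..s}" if "i \<le> n" for i
        using mono[of 0 i] mono[of i n] t that by auto
      then show ?thesis
        by (intro sum.neutral) (simp add: y)
    qed
    then have "curve_length \<gamma> 0 s \<le> 0"
      unfolding curve_length_def by (intro SUP_least) auto
    then show False
      using len[of 0 s] assms by (simp flip: ennreal_0 add: ennreal_le_iff2)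
  qed
  moreover have "continuous_on {0..s} \<gamma>"
    using assms by (auto simp: arc_length_curve_def rectifiable_curve_def
        intro: continuous_on_subset)
  ultimately show ?thesis
    using assms len by (auto simp: arc_length_curve_def rectifiable_curve_def)
qed

text \<open>Outside \<open>{0..l}\<close> the map \<open>\<gamma>\<close> is arbitrary, so
  measurability comes from continuity on the restricted space.\<close>

lemma borel_measurable_along_curve:
  fixes g :: "'a::metric_space \<Rightarrow> ennreal"
  assumes "arc_length_curve \<gamma> l" "g \<in> borel_measurable borel"
  shows "(\<lambda>s. g (\<gamma> s) * indicator {0..l} s) \<in> borel_measurable lborel"
proof -
  have "\<gamma> \<in> borel_measurable (restrict_space borel {0..l})"
    using assms by (intro borel_measurable_continuous_on_restrict)
      (simp add: arc_length_curve_def rectifiable_curve_def)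
  then have "(\<lambda>s. g (\<gamma> s)) \<in> borel_measurable (restrict_space borel {0..l})"
    using assms(2) by (rule measurable_compose)
  then show ?thesis
    by (subst (asm) borel_measurable_restrict_space_iff_ennreal) auto
qed

lemma curve_integral_suminf:
  fixes g :: "nat \<Rightarrow> 'a::metric_space \<Rightarrow> ennreal"
  assumes "arc_length_curve \<gamma> l" "\<And>n. g n \<in> borel_measurable borel"
  shows "(\<integral>\<^sup>+s\<in>{0..l}. (\<Sum>n. g n (\<gamma> s)) \<partial>lborel)
    = (\<Sum>n. \<integral>\<^sup>+s\<in>{0..l}. g n (\<gamma> s) \<partial>lborel)"
  using borel_measurable_along_curve[OF assms(1) assms(2)]
  by (simp flip: nn_integral_suminf ennreal_suminf_multc)

section \<open>Series and null sets in the function lattice\<close>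

context quasi_banach_function_lattice
begin

lemma borel_measurable_imp:
  assumes "f \<in> borel_measurable borel"
  shows "f \<in> borel_measurable M"
  using assms borel_measurable_sets
  by (auto simp: measurable_def space_eq_UNIV)

lemma norm_cong_AE:
  assumes "u \<in> borel_measurable M" "v \<in> borel_measurable M" "AE x in M. u x = v x"
  shows "N u = N v"
  using assms by (intro antisym norm_mono) auto

lemma fun_diff_measurable [measurable]:
  assumes [measurable]: "u \<in> borel_measurable M" "v \<in> borel_measurable M"
  shows "fun_diff u v \<in> borel_measurable M"
  unfolding fun_diff_def ext_diff_def by measurable

text \<open>Chosen so that the Riesz-Fischer factor \<open>c ^ Suc n\<close> times the n-th weight
  is \<open>\<epsilon> * (1/2) ^ Suc n\<close>; these products sum to
  \<open>\<epsilon>\<close>.\<close>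

definition weight :: "real \<Rightarrow> nat \<Rightarrow> ennreal" where
  "weight \<epsilon> n = ennreal (\<epsilon> * (1 / (2 * c)) ^ Suc n)"

lemma weight_pos: "0 < \<epsilon> \<Longrightarrow> 0 < weight \<epsilon> n"
  using modulus_ge_1 by (simp add: weight_def)

lemma norm_suminf_le:
  assumes "0 < \<epsilon>"
    and meas: "\<And>n. g n \<in> borel_measurable M"
    and le: "\<And>n. N (\<lambda>x. enn2ereal (g n x)) \<le> weight \<epsilon> n"
  shows "N (\<lambda>x. enn2ereal (\<Sum>n. g n x)) \<le> ennreal \<epsilon>"
proof -
  have "N (\<lambda>x. enn2ereal (\<Sum>n. g n x)) = N (\<lambda>x. \<Sum>n. enn2ereal (g n x))"
    by (simp add: suminf_enn2ereal)
  also have "\<dots> \<le> (\<Sum>n. ennreal (c ^ Suc n) * N (\<lambda>x. enn2ereal (g n x)))"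
    using meas by (intro riesz_fischer) auto
  also have "\<dots> \<le> (\<Sum>n. ennreal (c ^ Suc n) * weight \<epsilon> n)"
    by (intro suminf_le mult_left_mono le) auto
  also have "\<dots> = (\<Sum>n. ennreal (\<epsilon> * (1/2) ^ Suc n))"
    using modulus_ge_1 \<open>0 < \<epsilon>\<close>
    by (simp add: weight_def ennreal_mult' [symmetric] field_simps)
  also have "\<dots> = ennreal \<epsilon>"
  proof (rule suminf_ennreal_eq)
    show "(\<lambda>n. \<epsilon> * (1/2) ^ Suc n) sums \<epsilon>"
      using sums_mult[OF power_half_series, of \<epsilon>] by simp
  qed (use \<open>0 < \<epsilon>\<close> in simp)
  finally show ?thesis .
qed

text \<open>A Chebyshev argument: every multiple n of the indicator of the set lies below
  \<open>h\<close>, so n times its norm stays below the finite norm of \<open>h\<close>, and the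
  norm of the indicator is 0.\<close>

lemma null_infinite_set:
  assumes [measurable]: "h \<in> borel_measurable M" and fin: "N (\<lambda>x. enn2ereal (h x)) < \<infinity>"
  shows "{x. h x = \<infinity>} \<in> null_sets M"
proof -
  define A where "A = {x. h x = \<infinity>}"
  have "{x \<in> space M. h x = \<infinity>} \<in> sets M"
    by measurable
  then have A [measurable]: "A \<in> sets M"
    by (simp add: A_def space_eq_UNIV)
  let ?\<chi> = "indicator A :: 'a \<Rightarrow> ereal"
  have bound: "of_nat n * N ?\<chi> \<le> N (\<lambda>x. enn2ereal (h x))" for n
  proof -
    have "of_nat n * N ?\<chi> = N (\<lambda>x. ereal (real n) * ?\<chi> x)"
      by (subst norm_scale) (auto simp: ennreal_of_nat_eq_real_of_nat)
    also have "\<dots> \<le> N (\<lambda>x. enn2ereal (h x))"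
      by (intro norm_mono) (auto simp: A_def indicator_def)
    finally show ?thesis .
  qed
  have "N ?\<chi> = 0"
  proof (rule ccontr)
    assume "N ?\<chi> \<noteq> 0"
    then have "(SUP n. of_nat n * N ?\<chi>) = \<infinity>"
      by (simp add: SUP_mult_right_ennreal [symmetric] ennreal_SUP_of_nat_eq_top ennreal_top_mult)
    moreover have "(SUP n. of_nat n * N ?\<chi>) \<le> N (\<lambda>x. enn2ereal (h x))"
      by (intro SUP_least bound)
    ultimately have "\<infinity> \<le> N (\<lambda>x. enn2ereal (h x))"
      by (rule subst)
    then show False
      using fin by (simp add: top_unique)
  qed
  then have "AE x in M. ?\<chi> x = 0"
    by (subst (asm) norm_eq_0_iff) auto
  then have "AE x in M. x \<notin> A"
    by eventually_elim (auto simp: indicator_def split: if_splits)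
  then show ?thesis
    using A by (simp add: A_def AE_iff_null_sets)
qed

section \<open>Norm zero implies capacity zero\<close>

text \<open>If \<open>\<Sum>g\<^sub>k\<close> is built from upper gradients of \<open>w\<close> with rapidly vanishing norms, it has infinite
  integral along every curve on which the endpoint values of \<open>w\<close> differ; so it is an upper gradient
  of the indicator of \<open>{w \<noteq> 0}\<close>.\<close>

lemma newtonian_norm_indicator_support:
  assumes w [measurable]: "w \<in> borel_measurable M" and zero: "newtonian_norm N w = 0"
  shows "newtonian_norm N (indicator {x. w x \<noteq> 0}) = 0"
proof -
  let ?E = "{x. w x \<noteq> 0}" and ?\<chi> = "indicator {x. w x \<noteq> 0} :: 'a \<Rightarrow> ereal"
  have Nw: "N w = 0" and inf0: "(INF g \<in> {g. upper_gradient g w}. N (\<lambda>x. enn2ereal (g x))) = 0"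
    using zero by (auto simp: newtonian_norm_def)
  have "{x \<in> space M. w x \<noteq> 0} \<in> sets M"
    by measurable
  then have [measurable]: "?E \<in> sets M"
    by (simp add: space_eq_UNIV)
  have "AE x in M. w x = 0"
    using Nw norm_eq_0_iff[OF w] by simp
  then have "AE x in M. ?\<chi> x = 0"
    by eventually_elim (auto simp: indicator_def)
  then have N\<chi>: "N ?\<chi> = 0"
    by (subst norm_eq_0_iff) auto
  have "(INF g \<in> {g. upper_gradient g ?\<chi>}. N (\<lambda>x. enn2ereal (g x))) \<le> 0 + ennreal \<epsilon>"
    if "0 < \<epsilon>" for \<epsilon>
  proof -
    have "\<exists>g. upper_gradient g w \<and> N (\<lambda>x. enn2ereal (g x)) < weight \<epsilon> n" for n
    proof -
      have "(INF g \<in> {g. upper_gradient g w}. N (\<lambda>x. enn2ereal (g x))) < weight \<epsilon> n"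
        unfolding inf0 by (rule weight_pos[OF that])
      then show ?thesis
        by (simp add: INF_less_iff)
    qed
    then obtain g where g: "\<And>n. upper_gradient (g n) w"
      and Ng: "\<And>n. N (\<lambda>x. enn2ereal (g n x)) < weight \<epsilon> n"
      by metis
    have meas [measurable]: "g n \<in> borel_measurable borel" for n
      using g by (auto simp: upper_gradient_def)
    define G where "G x = (\<Sum>n. g n x)" for x
    have "upper_gradient G ?\<chi>"
      unfolding upper_gradient_def
    proof (intro conjI allI impI)
      show "G \<in> borel_measurable borel"
        unfolding G_def by measurable
    next
      fix \<gamma> :: "real \<Rightarrow> 'a" and l assume \<gamma>: "arc_length_curve \<gamma> l"
      let ?I = "\<lambda>n. \<integral>\<^sup>+s\<in>{0..l}. g n (\<gamma> s) \<partial>lborel"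
      have sum: "(\<integral>\<^sup>+s\<in>{0..l}. G (\<gamma> s) \<partial>lborel) = (\<Sum>n. ?I n)"
        unfolding G_def by (rule curve_integral_suminf[OF \<gamma> meas])
      show "\<bar>?\<chi> (\<gamma> 0) - ?\<chi> (\<gamma> l)\<bar> \<le> enn2ereal (\<integral>\<^sup>+s\<in>{0..l}. G (\<gamma> s) \<partial>lborel)"
      proof (cases "(\<Sum>n. ?I n) = \<infinity>")
        case True
        then show ?thesis
          by (simp add: sum)
      next
        case False
        then have "?I \<longlonglongrightarrow> 0"
          by (rule ennreal_suminf_finite_imp_tendsto_0)
        then have "(\<lambda>n. enn2ereal (?I n)) \<longlonglongrightarrow> 0"
          using tendsto_enn2erealI[of ?I 0] by (simp add: zero_ennreal.rep_eq)
        moreover have "\<bar>w (\<gamma> 0) - w (\<gamma> l)\<bar> \<le> enn2ereal (?I n)" for n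
          using g \<gamma> by (auto simp: upper_gradient_def)
        ultimately have "\<bar>w (\<gamma> 0) - w (\<gamma> l)\<bar> \<le> 0"
          by (intro LIMSEQ_le_const) auto
        \<comment> \<open>Infinite end values are excluded as well: the difference of two infinities
          has absolute value \<open>\<infinity>\<close> here.\<close>
        then have "w (\<gamma> 0) = w (\<gamma> l)"
          by (cases "w (\<gamma> 0)"; cases "w (\<gamma> l)") (auto simp flip: zero_ereal_def)
        then show ?thesis
          by (auto simp: indicator_def)
      qed
    qed
    moreover have "N (\<lambda>x. enn2ereal (G x)) \<le> ennreal \<epsilon>"
      unfolding G_def
      using that Ng by (intro norm_suminf_le borel_measurable_imp) (auto intro: less_imp_le)
    ultimately show ?thesis
      by (auto intro: INF_lower2)
  qed
  then have "(INF g \<in> {g. upper_gradient g ?\<chi>}. N (\<lambda>x. enn2ereal (g x))) \<le> 0"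
    by (rule ennreal_le_epsilon)
  then show ?thesis
    by (simp add: newtonian_norm_def N\<chi>)
qed

lemma capacity_zero_of_norm_zero:
  assumes "w \<in> borel_measurable M" "newtonian_norm N w = 0"
  shows "sobolev_capacity M N {x. w x \<noteq> 0} = 0"
proof -
  have "{x \<in> space M. w x \<noteq> 0} \<in> sets M"
    using assms(1) by measurable
  then have "(indicator {x. w x \<noteq> 0} :: 'a \<Rightarrow> ereal) \<in> borel_measurable M"
    by (simp add: space_eq_UNIV)
  with newtonian_norm_indicator_support[OF assms]
  have "sobolev_capacity M N {x. w x \<noteq> 0} \<le> 0"
    unfolding sobolev_capacity_def newtonian_space_def
    by (intro INF_lower2[where i = "indicator {x. w x \<noteq> 0}"]) auto
  then show ?thesis
    by simp
qed

section \<open>Capacity zero implies norm zero\<close>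

text \<open>Were the sum finite at \<open>\<gamma> s\<close>, some \<open>u n\<close> would be close
  to 0 there and, its upper gradient having small integral, close to 0 at both ends too, although it
  is at least 1 at one of them.\<close>

lemma sum_infinite_along_curve:
  fixes u :: "nat \<Rightarrow> 'a \<Rightarrow> ereal"
  assumes \<gamma>: "arc_length_curve \<gamma> l"
    and g: "\<And>n. upper_gradient (g n) (u n)"
    and fin: "(\<integral>\<^sup>+s\<in>{0..l}. (\<Sum>n. g n (\<gamma> s)) \<partial>lborel) \<noteq> \<infinity>"
    and E: "\<gamma> 0 \<in> E \<or> \<gamma> l \<in> E" "\<And>n x. x \<in> E \<Longrightarrow> 1 \<le> u n x"
    and s: "0 < s" "s \<le> l"
  shows "(\<Sum>n. e2ennreal \<bar>u n (\<gamma> s)\<bar>) = \<infinity>"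
proof (rule ccontr)
  let ?I = "\<lambda>n t. \<integral>\<^sup>+s\<in>{0..t}. g n (\<gamma> s) \<partial>lborel"
  assume "(\<Sum>n. e2ennreal \<bar>u n (\<gamma> s)\<bar>) \<noteq> \<infinity>"
  then have lim_u: "(\<lambda>n. e2ennreal \<bar>u n (\<gamma> s)\<bar>) \<longlonglongrightarrow> 0"
    by (rule ennreal_suminf_finite_imp_tendsto_0)
  have "g n \<in> borel_measurable borel" for n
    using g by (auto simp: upper_gradient_def)
  then have "(\<Sum>n. ?I n l) \<noteq> \<infinity>"
    using fin by (subst (asm) curve_integral_suminf[OF \<gamma>]) auto
  then have lim_I: "(\<lambda>n. ?I n l) \<longlonglongrightarrow> 0"
    by (rule ennreal_suminf_finite_imp_tendsto_0)
  \<comment> \<open>Three errors add up, at \<open>\<gamma> s\<close>, from there to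
    \<open>\<gamma> 0\<close>, and on to \<open>\<gamma> l\<close>; with 1/4 for each, the total
    stays below 1.\<close>
  have "0 < ennreal (1/4)"
    by simp
  with lim_u lim_I
  have "\<forall>\<^sub>F n in sequentially. e2ennreal \<bar>u n (\<gamma> s)\<bar> < ennreal (1/4) \<and> ?I n l < ennreal (1/4)"
    by (intro eventually_conj order_tendstoD(2))
  then obtain n where "e2ennreal \<bar>u n (\<gamma> s)\<bar> < ennreal (1/4)" and I: "?I n l < ennreal (1/4)"
    by (auto simp: eventually_sequentially)
  then have us: "\<bar>u n (\<gamma> s)\<bar> < ereal (1/4)"
    by (cases "u n (\<gamma> s)") (auto simp: ennreal_less_iff e2ennreal_ereal)
  \<comment> \<open>Only segments starting at parameter 0 are compared, which avoids
    reparametrization; \<open>\<gamma> l\<close> is reached from \<open>\<gamma> s\<close> through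
    \<open>\<gamma> 0\<close>.\<close>
  have diff: "\<bar>u n (\<gamma> 0) - u n (\<gamma> t)\<bar> < ereal (1/4)" if "0 < t" "t \<le> l" for t
  proof -
    have "\<bar>u n (\<gamma> 0) - u n (\<gamma> t)\<bar> \<le> enn2ereal (?I n t)"
      using g arc_length_curve_initial[OF \<gamma> that] by (auto simp: upper_gradient_def)
    also have "?I n t \<le> ?I n l"
      using that by (intro nn_integral_mono) (auto simp: indicator_def)
    then have "enn2ereal (?I n t) \<le> enn2ereal (?I n l)"
      by (simp add: less_eq_ennreal.rep_eq)
    also have "\<dots> < ereal (1/4)"
      using I by (simp add: less_ennreal.rep_eq)
    finally show ?thesis .
  qed
  have "1 \<le> u n (\<gamma> 0) \<or> 1 \<le> u n (\<gamma> l)"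
    using E by auto
  moreover obtain d where d: "u n (\<gamma> s) = ereal d" "\<bar>d\<bar> < 1/4"
    using us by (cases "u n (\<gamma> s)") auto
  moreover obtain a where a: "u n (\<gamma> 0) = ereal a" "\<bar>a - d\<bar> < 1/4"
    using diff[OF s] d(1) by (cases "u n (\<gamma> 0)") auto
  moreover obtain b where "u n (\<gamma> l) = ereal b" "\<bar>a - b\<bar> < 1/4"
    using diff[OF arc_length_curve_pos[OF \<gamma>] order_refl] a(1) by (cases "u n (\<gamma> l)") auto
  ultimately have "1 \<le> a \<or> 1 \<le> b" "\<bar>d\<bar> < 1/4" "\<bar>a - d\<bar> < 1/4" "\<bar>a - b\<bar> < 1/4"
    by simp_all
  then show False
    by argo
qed

text \<open>The functions \<open>u\<^sub>k\<close> are competitors for the capacity of \<open>{w \<noteq> 0}\<close> with rapidly vanishing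
  norms. Along a curve with an endpoint in \<open>{w \<noteq> 0}\<close>, either \<open>\<Sum>g\<^sub>k\<close> has infinite integral or
  \<open>\<Sum>\<bar>u\<^sub>k\<bar> = \<infinity>\<close> almost everywhere on the curve. The latter happens only on a null set, on a
  Borel null superset of which the upper gradient may be raised to \<open>\<infinity>\<close> at no cost.\<close>

lemma norm_zero_of_capacity_zero:
  assumes w [measurable]: "w \<in> borel_measurable M"
    and cap: "sobolev_capacity M N {x. w x \<noteq> 0} = 0"
  shows "newtonian_norm N w = 0"
proof -
  let ?E = "{x. w x \<noteq> 0}"
  have "{x \<in> space M. w x \<noteq> 0} \<in> sets M"
    by measurable
  then have [measurable]: "?E \<in> sets M"
    by (simp add: space_eq_UNIV)
  have ex: "\<exists>u g. u \<in> borel_measurable M \<and> (\<forall>x\<in>?E. 1 \<le> u x) \<and> N u < \<delta> \<and>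
      upper_gradient g u \<and> N (\<lambda>x. enn2ereal (g x)) < \<delta>" if \<delta>: "0 < \<delta>" for \<delta>
  proof -
    from cap \<delta> obtain u where u: "u \<in> newtonian_space M N" "\<forall>x\<in>?E. 1 \<le> u x"
      and nu: "newtonian_norm N u < \<delta>"
      unfolding sobolev_capacity_def by (metis (mono_tags, lifting) INF_less_iff mem_Collect_eq)
    have "N u < \<delta>" "(INF g \<in> {g. upper_gradient g u}. N (\<lambda>x. enn2ereal (g x))) < \<delta>"
      using nu unfolding newtonian_norm_def by (auto intro: le_less_trans[rotated])
    with u show ?thesis
      by (auto simp: INF_less_iff newtonian_space_def)
  qed
  \<comment> \<open>The indicator of \<open>?E\<close> lies below \<bar>u\<bar> for every competitor
    \<open>u\<close>, and competitors have arbitrarily small norm.\<close>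
  have "N (indicator ?E) \<le> 0 + ennreal \<epsilon>" if "0 < \<epsilon>" for \<epsilon>
  proof -
    obtain u where u [measurable]: "u \<in> borel_measurable M"
      and "\<forall>x\<in>?E. 1 \<le> u x" "N u < ennreal \<epsilon>"
      using ex[of "ennreal \<epsilon>"] \<open>0 < \<epsilon>\<close> unfolding ennreal_less_zero_iff by blast
    moreover have "\<bar>indicator ?E x\<bar> \<le> \<bar>u x\<bar>" for x
      using \<open>\<forall>x\<in>?E. 1 \<le> u x\<close> by (cases "u x") (auto simp: indicator_def)
    then have "N (indicator ?E) \<le> N u"
      by (intro norm_mono AE_I2) auto
    ultimately show ?thesis
      by simp
  qed
  then have "N (indicator ?E) \<le> 0"
    by (rule ennreal_le_epsilon)
  then have "AE x in M. indicator ?E x = (0::ereal)"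
    by (subst norm_eq_0_iff[symmetric]) auto
  then have "AE x in M. w x = 0"
    by eventually_elim (auto simp: indicator_def split: if_splits)
  then have Nw: "N w = 0"
    by (subst norm_eq_0_iff) auto
  have "(INF g \<in> {g. upper_gradient g w}. N (\<lambda>x. enn2ereal (g x))) \<le> 0 + ennreal \<epsilon>"
    if "0 < \<epsilon>" for \<epsilon>
  proof -
    obtain u g where u [measurable]: "\<And>n. u n \<in> borel_measurable M"
      and u1: "\<And>n x. x \<in> ?E \<Longrightarrow> 1 \<le> u n x" and Nu: "\<And>n. N (u n) < weight \<epsilon> n"
      and g: "\<And>n. upper_gradient (g n) (u n)"
      and Ng: "\<And>n. N (\<lambda>x. enn2ereal (g n x)) < weight \<epsilon> n"
      using ex[OF weight_pos[OF \<open>0 < \<epsilon>\<close>]] by metis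
    have meas [measurable]: "g n \<in> borel_measurable borel" for n
      using g by (auto simp: upper_gradient_def)
    define G where "G x = (\<Sum>n. g n x)" for x
    have [measurable]: "G \<in> borel_measurable borel"
      unfolding G_def by measurable
    define U where "U x = (\<Sum>n. e2ennreal \<bar>u n x\<bar>)" for x
    have [measurable]: "U \<in> borel_measurable M"
      unfolding U_def by measurable
    have "N (\<lambda>x. enn2ereal (e2ennreal \<bar>u n x\<bar>)) \<le> weight \<epsilon> n" for n
    proof -
      have "N (\<lambda>x. enn2ereal (e2ennreal \<bar>u n x\<bar>)) \<le> N (u n)"
        by (intro norm_mono) (auto simp: enn2ereal_e2ennreal)
      with Nu[of n] show ?thesis
        by simp
    qed
    then have "N (\<lambda>x. enn2ereal (U x)) \<le> ennreal \<epsilon>"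
      unfolding U_def using that by (intro norm_suminf_le) auto
    then have "N (\<lambda>x. enn2ereal (U x)) < \<infinity>"
      by (auto intro: le_less_trans)
    then have "{x. U x = \<infinity>} \<in> null_sets M"
      by (intro null_infinite_set) auto
    \<comment> \<open>\<open>U\<close> is only measurable with respect to \<open>M\<close>, while an
      upper gradient must be Borel; hence the passage to a Borel superset.\<close>
    then obtain D where D [measurable]: "D \<in> sets borel" and UD: "{x. U x = \<infinity>} \<subseteq> D"
      and D0: "emeasure M D = 0"
      using borel_regular[of "{x. U x = \<infinity>}"] by (auto simp: null_sets_def)
    define F where "F x = G x + top * indicator D x" for x
    have F [measurable]: "F \<in> borel_measurable borel"
      unfolding F_def by measurable
    have "D \<in> null_sets M"
      using D D0 borel_measurable_sets by (auto simp: null_sets_def)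
    then have "AE x in M. x \<notin> D"
      by (rule AE_not_in)
    then have "AE x in M. enn2ereal (F x) = enn2ereal (G x)"
      by eventually_elim (auto simp: F_def)
    then have "N (\<lambda>x. enn2ereal (F x)) = N (\<lambda>x. enn2ereal (G x))"
      by (intro norm_cong_AE borel_measurable_imp) auto
    also have "\<dots> \<le> ennreal \<epsilon>"
      unfolding G_def
      using that Ng by (intro norm_suminf_le borel_measurable_imp) (auto intro: less_imp_le)
    finally have NF: "N (\<lambda>x. enn2ereal (F x)) \<le> ennreal \<epsilon>" .
    have "upper_gradient F w"
      unfolding upper_gradient_def
    proof (intro conjI allI impI F)
      fix \<gamma> :: "real \<Rightarrow> 'a" and l assume \<gamma>: "arc_length_curve \<gamma> l"
      show "\<bar>w (\<gamma> 0) - w (\<gamma> l)\<bar> \<le> enn2ereal (\<integral>\<^sup>+s\<in>{0..l}. F (\<gamma> s) \<partial>lborel)"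
      proof (cases "\<gamma> 0 \<in> ?E \<or> \<gamma> l \<in> ?E")
        case False
        then show ?thesis
          by simp
      next
        case E: True
        have "(\<integral>\<^sup>+s\<in>{0..l}. F (\<gamma> s) \<partial>lborel) = \<infinity>"
        proof (cases "(\<integral>\<^sup>+s\<in>{0..l}. G (\<gamma> s) \<partial>lborel) = \<infinity>")
          case True
          moreover have "(\<integral>\<^sup>+s\<in>{0..l}. G (\<gamma> s) \<partial>lborel) \<le> (\<integral>\<^sup>+s\<in>{0..l}. F (\<gamma> s) \<partial>lborel)"
            by (intro nn_integral_mono) (auto simp: F_def indicator_def)
          ultimately show ?thesis
            by (simp add: top_unique)
        next
          case False
          \<comment> \<open>The parameter 0 is left out because the segment from 0 to 0 is no curve;
            the half-open interval still has positive length, so the integral is infinite.\<close>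
          have FD: "F (\<gamma> s) = \<infinity>" if "s \<in> {0<..l}" for s
          proof -
            have "U (\<gamma> s) = \<infinity>"
              unfolding U_def
              using sum_infinite_along_curve[OF \<gamma> g False[unfolded G_def] E u1] that by auto
            with UD have "\<gamma> s \<in> D"
              by auto
            then show ?thesis
              by (simp add: F_def)
          qed
          have "\<infinity> = (\<integral>\<^sup>+s\<in>{0<..l}. \<infinity> \<partial>lborel)"
            using arc_length_curve_pos[OF \<gamma>]
            by (subst nn_integral_cmult_indicator) (auto simp: ennreal_top_mult)
          also have "\<dots> \<le> (\<integral>\<^sup>+s\<in>{0..l}. F (\<gamma> s) \<partial>lborel)"
            by (intro nn_integral_mono) (auto simp: FD indicator_def)
          finally show ?thesis
            by (simp add: top_unique)
        qed
        then show ?thesis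
          by simp
      qed
    qed
    with NF show ?thesis
      by (auto intro: INF_lower2)
  qed
  then have "(INF g \<in> {g. upper_gradient g w}. N (\<lambda>x. enn2ereal (g x))) \<le> 0"
    by (rule ennreal_le_epsilon)
  then show ?thesis
    by (simp add: newtonian_norm_def Nw)
qed

section \<open>Differences and equivalence classes\<close>

lemma newtonian_norm_diff_eq_0_iff:
  assumes "u \<in> newtonian_space M N" "v \<in> newtonian_space M N"
  shows "newtonian_norm N (fun_diff u v) = 0 \<longleftrightarrow> sobolev_capacity M N {x. u x \<noteq> v x} = 0"
proof -
  have "fun_diff u v \<in> borel_measurable M"
    using assms by (intro fun_diff_measurable) (auto simp: newtonian_space_def)
  moreover have "{x. fun_diff u v x \<noteq> 0} = {x. u x \<noteq> v x}"
    by (simp add: fun_diff_def ext_diff_eq_0_iff)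
  ultimately show ?thesis
    using capacity_zero_of_norm_zero norm_zero_of_capacity_zero by metis
qed

end

theorem corollary6p16:
  fixes M :: "'a::metric_space measure"
    and N :: "('a \<Rightarrow> ereal) \<Rightarrow> ennreal"
    and c :: real
  assumes "quasi_banach_function_lattice M N c"
  shows "newtonian_quotient M N =
      {{v \<in> newtonian_space M N. sobolev_capacity M N {x. u x \<noteq> v x} = 0} | u.
        u \<in> newtonian_space M N} \<and>
    (\<forall>u\<in>newtonian_space M N. \<forall>v\<in>newtonian_space M N.
      newtonian_norm N (fun_diff u v) = 0 \<longleftrightarrow>
      sobolev_capacity M N {x. u x \<noteq> v x} = 0)"
proof -
  note iff = quasi_banach_function_lattice.newtonian_norm_diff_eq_0_iff[OF assms]
  \<comment> \<open>The class of \<open>u\<close> is its image under the relation, so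
    \<open>iff\<close> also describes the quotient.\<close>
  have "newtonian_rel M N `` {u} =
      {v \<in> newtonian_space M N. sobolev_capacity M N {x. u x \<noteq> v x} = 0}"
    if "u \<in> newtonian_space M N" for u
    using that iff by (auto simp: newtonian_rel_def)
  then have "newtonian_quotient M N =
      {{v \<in> newtonian_space M N. sobolev_capacity M N {x. u x \<noteq> v x} = 0} | u.
        u \<in> newtonian_space M N}"
    unfolding newtonian_quotient_def quotient_def by auto
  with iff show ?thesis
    by blast
qed

end
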